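(* Let $(g^\pm_{v\alpha},\xi_{\alpha\Delta})$ be a critical point of the action $S_0$ with $J_\Delta=\sum_{f\in\Delta}j_f$. Then the configuration $(g^\pm_{v\alpha},\xi_{\alpha f})$ obtained by keeping the same group elements $g^\pm_{v\alpha}$ and setting $\xi_{\alpha f}=\xi_{\alpha\Delta}$ (up to a phase) for all $\alpha$, all $\Delta\subset\alpha$ and all $f\in\Delta$ is a critical point of the action $S$. In other words, critical points of $S_0$ are also critical points of $S$.
   Context: Combinatorial data. $\mathcal K_s$ is a finite 4-dimensional simplicial complex (possibly with boundary), with 4-simplices $v$, tetrahedra $\alpha,\beta,\dots$ and triangles $\Delta$. Each tetrahedron lies in at most two 4-simplices; it is internal if it lies in two and boundary if it lies in one. In each 4-simplex $v$ every triangle $\Delta\subset v$ is shared by exactly two of the five tetrahedra of $v$. The face dual to $\Delta$ is oriented, and this orders these two tetrahedra as a pair $(\alpha,\beta)$ for every $v\supset\Delta$. The orderings are consistent around $\Delta$: if an internal tetrahedron $\alpha\supset\Delta$ is shared by $v$ and $v'$, then $\alpha$ is the first member of the pair in one of $v,v'$ and the second member in the other. Each triangle $\Delta$ is subdivided into a finite nonempty set of facets, written $f\in\Delta$, each carrying a nonzero spin $j_f\in\frac12\mathbb Z_{>0}$. This turns $\mathcal K_s$ into a cellular complex $\mathcal K$ in which tetrahedra become polyhedra with many facets. Variables. $0<\gamma<1$ is fixed, and $j_f^\pm=\frac{1\pm\gamma}{2}j_f$, $J_\Delta=\sum_{f\in\Delta}j_f$, $J_\Delta^\pm=\sum_{f\in\Delta}j_f^\pm=\frac{1\pm\gamma}{2}J_\Delta$.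 For each pair $\alpha\subset v$ there are $g^+_{v\alpha},g^-_{v\alpha}\in SU(2)$. The $\xi$'s are unit vectors in $\mathbb C^2$ with the standard Hermitian inner product. Actions. In both sums, $(\alpha,\beta)$ is the ordered pair of tetrahedra of $v$ sharing the triangle $\Delta$ (for $S$, the triangle $\Delta\ni f$): $$S=\sum_{\pm}\sum_{v,\,f}2j_f^\pm\ln\langle\xi_{\alpha f}|(g^\pm_{v\alpha})^{-1}g^\pm_{v\beta}|\xi_{\beta f}\rangle ,\qquad S_0=\sum_{\pm}\sum_{v,\,\Delta}2J_\Delta^\pm\ln\langle\xi_{\alpha\Delta}|(g^\pm_{v\alpha})^{-1}g^\pm_{v\beta}|\xi_{\beta\Delta}\rangle .$$ $S$ is a function of all $g^\pm_{v\alpha}$ and of one unit vector $\xi_{\alpha f}$ for each pair (internal $\alpha$, facet $f$ of $\alpha$). $S_0$ is a function of all $g^\pm_{v\alpha}$ and of one unit vector $\xi_{\alpha\Delta}$ for each pair (internal $\alpha$, triangle $\Delta\subset\alpha$). The vectors at boundary tetrahedra are fixed boundary data satisfying the parallel restriction: $\xi_{\alpha f}=e^{i\varphi_{\alpha f}}\xi_{\alpha\Delta}$ for all $f\in\Delta$. The spins are fixed. Only $\mathrm{Re}$ and first derivatives of the actions are used, so the branch of the logarithm is irrelevant. Critical points. A critical point of $S$ is a configuration at which $\mathrm{Re}(S)=0$ and the derivatives of $S$ with respect to all $g^\pm_{v\alpha}\in SU(2)$ and all internal unit vectors $\xi_{\alpha f}$ vanish. A critical point of $S_0$ is a configuration at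 which $\mathrm{Re}(S_0)=0$ and the derivatives of $S_0$ with respect to all $g^\pm_{v\alpha}$ and all internal unit vectors $\xi_{\alpha\Delta}$ vanish. Internal $\xi$'s may be multiplied by arbitrary phases (a gauge symmetry); critical points are considered modulo gauge. *)

theory Defs
  imports "HOL-Analysis.Analysis"
begin

section \<open>Hermitian product on two-dimensional complex space, SU(2), logarithms\<close>

definition braket :: "complex^2 \<Rightarrow> complex^2 \<Rightarrow> complex" where
  "braket x y = (\<Sum>i\<in>UNIV. cnj (x $ i) * y $ i)"

definition adjoint_mat :: "complex^2^2 \<Rightarrow> complex^2^2" where
  "adjoint_mat A = (\<chi> i j. cnj (A $ j $ i))"

definition SU2 :: "(complex^2^2) set" where
  "SU2 = {A. adjoint_mat A ** A = mat 1 \<and> A ** adjoint_mat A = mat 1 \<and> det A = 1}"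

text \<open>\<open>l\<close> is a branch of the logarithm near \<open>w\<close>; such branches exist iff \<open>w \<noteq> 0\<close>, and any two of them
  differ by a constant near \<open>w\<close>.\<close>

definition log_branch_at :: "(complex \<Rightarrow> complex) \<Rightarrow> complex \<Rightarrow> bool" where
  "log_branch_at l w \<longleftrightarrow>
     (\<exists>U. open U \<and> w \<in> U \<and> l holomorphic_on U \<and> (\<forall>z\<in>U. exp (l z) = z))"

text \<open>\<open>F\<close>, as a function on the submanifold \<open>M\<close>, has vanishing differential at \<open>x \<in> M\<close>.
  The derivative is taken within \<open>M\<close>, so only the values of \<open>F\<close> on \<open>M\<close> matter and only the tangent
  directions of \<open>M\<close> are constrained.\<close>

definition stationary_on ::
  "'m::real_normed_vector set \<Rightarrow> ('m \<Rightarrow> complex) \<Rightarrow> 'm \<Rightarrow> bool" where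
  "stationary_on M F x \<longleftrightarrow> (F has_derivative (\<lambda>_. 0)) (at x within M)"

section \<open>Combinatorial data\<close>

datatype sign = Plus | Minus

text \<open>\<open>first_tet D v \<Delta>\<close> and \<open>second_tet D v \<Delta>\<close> form the ordered pair \<open>(\<alpha>, \<beta>)\<close> of tetrahedra of \<open>v\<close>
  that share \<open>\<Delta>\<close>. The fields \<open>bdry_facet\<close> and \<open>bdry_tri\<close> are the fixed vectors \<open>\<xi>\<close> at boundary
  tetrahedra for \<open>S\<close> and for \<open>S\<^sub>0\<close>.\<close>

record ('p, 'f) spinfoam_data =
  complex_of :: "'p set set"
  first_tet :: "'p set \<Rightarrow> 'p set \<Rightarrow> 'p set"
  second_tet :: "'p set \<Rightarrow> 'p set \<Rightarrow> 'p set"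
  facets :: "'p set \<Rightarrow> 'f set"
  spin :: "'f \<Rightarrow> real"
  immirzi :: real
  bdry_facet :: "'p set \<Rightarrow> 'f \<Rightarrow> complex^2"
  bdry_tri :: "'p set \<Rightarrow> 'p set \<Rightarrow> complex^2"

definition simplices4 :: "('p::euclidean_space, 'f) spinfoam_data \<Rightarrow> 'p set set" where
  "simplices4 D = {v \<in> complex_of D. 4 simplex v}"

definition tets :: "('p::euclidean_space, 'f) spinfoam_data \<Rightarrow> 'p set set" where
  "tets D = {\<alpha> \<in> complex_of D. 3 simplex \<alpha>}"

definition tris :: "('p::euclidean_space, 'f) spinfoam_data \<Rightarrow> 'p set set" where
  "tris D = {\<Delta> \<in> complex_of D. 2 simplex \<Delta>}"

text \<open>Within a simplicial complex, inclusion of simplices is the same as the face relation.\<close>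

definition tris_in :: "('p::euclidean_space, 'f) spinfoam_data \<Rightarrow> 'p set \<Rightarrow> 'p set set" where
  "tris_in D s = {\<Delta> \<in> tris D. \<Delta> \<subseteq> s}"

definition internal_tet :: "('p::euclidean_space, 'f) spinfoam_data \<Rightarrow> 'p set \<Rightarrow> bool" where
  "internal_tet D \<alpha> \<longleftrightarrow> \<alpha> \<in> tets D \<and> card {v \<in> simplices4 D. \<alpha> \<subseteq> v} = 2"

definition boundary_tet :: "('p::euclidean_space, 'f) spinfoam_data \<Rightarrow> 'p set \<Rightarrow> bool" where
  "boundary_tet D \<alpha> \<longleftrightarrow> \<alpha> \<in> tets D \<and> card {v \<in> simplices4 D. \<alpha> \<subseteq> v} = 1"

definition four_dim_complex :: "('p::euclidean_space, 'f) spinfoam_data \<Rightarrow> bool" where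
  "four_dim_complex D \<longleftrightarrow>
     simplicial_complex (complex_of D) \<and>
     simplices4 D \<noteq> {} \<and> (\<forall>s\<in>complex_of D. aff_dim s \<le> 4) \<and>
     (\<forall>\<alpha>\<in>tets D. card {v \<in> simplices4 D. \<alpha> \<subseteq> v} \<le> 2)"

definition consistent_orientation :: "('p::euclidean_space, 'f) spinfoam_data \<Rightarrow> bool" where
  "consistent_orientation D \<longleftrightarrow>
     (\<forall>v\<in>simplices4 D. \<forall>\<Delta>\<in>tris_in D v.
        first_tet D v \<Delta> \<noteq> second_tet D v \<Delta> \<and>
        {first_tet D v \<Delta>, second_tet D v \<Delta>} = {\<alpha> \<in> tets D. \<Delta> \<subseteq> \<alpha> \<and> \<alpha> \<subseteq> v}) \<and>
     (\<forall>\<alpha> v v' \<Delta>. internal_tet D \<alpha> \<and> \<Delta> \<in> tris_in D \<alpha> \<and>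
        v \<in> simplices4 D \<and> v' \<in> simplices4 D \<and> v \<noteq> v' \<and> \<alpha> \<subseteq> v \<and> \<alpha> \<subseteq> v' \<longrightarrow>
        (\<alpha> = first_tet D v \<Delta> \<and> \<alpha> = second_tet D v' \<Delta>) \<or>
        (\<alpha> = second_tet D v \<Delta> \<and> \<alpha> = first_tet D v' \<Delta>))"

definition valid_facets :: "('p::euclidean_space, 'f) spinfoam_data \<Rightarrow> bool" where
  "valid_facets D \<longleftrightarrow>
     (\<forall>\<Delta>\<in>tris D. finite (facets D \<Delta>) \<and> facets D \<Delta> \<noteq> {}) \<and>
     (\<forall>\<Delta>\<in>tris D. \<forall>\<Delta>'\<in>tris D. \<Delta> \<noteq> \<Delta>' \<longrightarrow> facets D \<Delta> \<inter> facets D \<Delta>' = {}) \<and>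
     (\<forall>\<Delta>\<in>tris D. \<forall>f\<in>facets D \<Delta>. \<exists>n::nat. n > 0 \<and> spin D f = real n / 2)"

text \<open>The last conjunct is the parallel restriction on the boundary data.\<close>

definition valid_boundary :: "('p::euclidean_space, 'f) spinfoam_data \<Rightarrow> bool" where
  "valid_boundary D \<longleftrightarrow>
     (\<forall>\<alpha> \<Delta>. boundary_tet D \<alpha> \<and> \<Delta> \<in> tris_in D \<alpha> \<longrightarrow>
        norm (bdry_tri D \<alpha> \<Delta>) = 1 \<and>
        (\<forall>f\<in>facets D \<Delta>. norm (bdry_facet D \<alpha> f) = 1 \<and>
           (\<exists>\<phi>::real. bdry_facet D \<alpha> f = cis \<phi> *s bdry_tri D \<alpha> \<Delta>)))"

definition spinfoam :: "('p::euclidean_space, 'f) spinfoam_data \<Rightarrow> bool" where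
  "spinfoam D \<longleftrightarrow>
     four_dim_complex D \<and> consistent_orientation D \<and> valid_facets D \<and> valid_boundary D \<and>
     0 < immirzi D \<and> immirzi D < 1"

section \<open>Spins\<close>

definition pm_factor :: "('p, 'f) spinfoam_data \<Rightarrow> sign \<Rightarrow> real" where
  "pm_factor D s = (case s of Plus \<Rightarrow> (1 + immirzi D) / 2 | Minus \<Rightarrow> (1 - immirzi D) / 2)"

definition spin_pm :: "('p, 'f) spinfoam_data \<Rightarrow> sign \<Rightarrow> 'f \<Rightarrow> real" where
  "spin_pm D s f = pm_factor D s * spin D f"

definition J_tri :: "('p, 'f) spinfoam_data \<Rightarrow> 'p set \<Rightarrow> real" where
  "J_tri D \<Delta> = (\<Sum>f\<in>facets D \<Delta>. spin D f)"

definition J_tri_pm :: "('p, 'f) spinfoam_data \<Rightarrow> sign \<Rightarrow> 'p set \<Rightarrow> real" where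
  "J_tri_pm D s \<Delta> = pm_factor D s * J_tri D \<Delta>"

section \<open>Configurations and actions\<close>

type_synonym 'p group_vars = "sign \<Rightarrow> 'p set \<Rightarrow> 'p set \<Rightarrow> complex^2^2"

definition valid_group_vars ::
  "('p::euclidean_space, 'f) spinfoam_data \<Rightarrow> 'p group_vars \<Rightarrow> bool" where
  "valid_group_vars D g \<longleftrightarrow>
     (\<forall>s. \<forall>v\<in>simplices4 D. \<forall>\<alpha>\<in>tets D. \<alpha> \<subseteq> v \<longrightarrow> g s v \<alpha> \<in> SU2)"

definition valid_facet_vecs ::
  "('p::euclidean_space, 'f) spinfoam_data \<Rightarrow> ('p set \<Rightarrow> 'f \<Rightarrow> complex^2) \<Rightarrow> bool" where
  "valid_facet_vecs D \<xi> \<longleftrightarrow>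
     (\<forall>\<alpha>. internal_tet D \<alpha> \<longrightarrow> (\<forall>\<Delta>\<in>tris_in D \<alpha>. \<forall>f\<in>facets D \<Delta>. norm (\<xi> \<alpha> f) = 1))"

definition valid_tri_vecs ::
  "('p::euclidean_space, 'f) spinfoam_data \<Rightarrow> ('p set \<Rightarrow> 'p set \<Rightarrow> complex^2) \<Rightarrow> bool" where
  "valid_tri_vecs D \<xi> \<longleftrightarrow>
     (\<forall>\<alpha>. internal_tet D \<alpha> \<longrightarrow> (\<forall>\<Delta>\<in>tris_in D \<alpha>. norm (\<xi> \<alpha> \<Delta>) = 1))"

text \<open>Only the vectors at internal tetrahedra are variables; all others are read from the boundary
  data.\<close>

definition facet_vec ::
  "('p::euclidean_space, 'f) spinfoam_data \<Rightarrow> ('p set \<Rightarrow> 'f \<Rightarrow> complex^2)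
     \<Rightarrow> 'p set \<Rightarrow> 'f \<Rightarrow> complex^2" where
  "facet_vec D \<xi> \<alpha> f = (if internal_tet D \<alpha> then \<xi> \<alpha> f else bdry_facet D \<alpha> f)"

definition tri_vec ::
  "('p::euclidean_space, 'f) spinfoam_data \<Rightarrow> ('p set \<Rightarrow> 'p set \<Rightarrow> complex^2)
     \<Rightarrow> 'p set \<Rightarrow> 'p set \<Rightarrow> complex^2" where
  "tri_vec D \<xi> \<alpha> \<Delta> = (if internal_tet D \<alpha> then \<xi> \<alpha> \<Delta> else bdry_tri D \<alpha> \<Delta>)"

definition amp_facet ::
  "('p::euclidean_space, 'f) spinfoam_data \<Rightarrow> 'p group_vars \<Rightarrow> ('p set \<Rightarrow> 'f \<Rightarrow> complex^2)
     \<Rightarrow> sign \<Rightarrow> 'p set \<Rightarrow> 'p set \<Rightarrow> 'f \<Rightarrow> complex" where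
  "amp_facet D g \<xi> s v \<Delta> f =
     (let \<alpha> = first_tet D v \<Delta>; \<beta> = second_tet D v \<Delta> in
      braket (facet_vec D \<xi> \<alpha> f)
        ((matrix_inv (g s v \<alpha>) ** g s v \<beta>) *v facet_vec D \<xi> \<beta> f))"

definition amp_tri ::
  "('p::euclidean_space, 'f) spinfoam_data \<Rightarrow> 'p group_vars \<Rightarrow> ('p set \<Rightarrow> 'p set \<Rightarrow> complex^2)
     \<Rightarrow> sign \<Rightarrow> 'p set \<Rightarrow> 'p set \<Rightarrow> complex" where
  "amp_tri D g \<xi> s v \<Delta> =
     (let \<alpha> = first_tet D v \<Delta>; \<beta> = second_tet D v \<Delta> in
      braket (tri_vec D \<xi> \<alpha> \<Delta>)
        ((matrix_inv (g s v \<alpha>) ** g s v \<beta>) *v tri_vec D \<xi> \<beta> \<Delta>))"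

text \<open>The argument \<open>l\<close> supplies the branch of the logarithm used in each term of the action.\<close>

definition action_S ::
  "('p::euclidean_space, 'f) spinfoam_data \<Rightarrow> (sign \<Rightarrow> 'p set \<Rightarrow> 'f \<Rightarrow> complex \<Rightarrow> complex)
     \<Rightarrow> 'p group_vars \<Rightarrow> ('p set \<Rightarrow> 'f \<Rightarrow> complex^2) \<Rightarrow> complex" where
  "action_S D l g \<xi> =
     (\<Sum>s\<in>{Plus, Minus}. \<Sum>v\<in>simplices4 D. \<Sum>\<Delta>\<in>tris_in D v. \<Sum>f\<in>facets D \<Delta>.
        2 * of_real (spin_pm D s f) * l s v f (amp_facet D g \<xi> s v \<Delta> f))"

definition action_S0 ::
  "('p::euclidean_space, 'f) spinfoam_data \<Rightarrow> (sign \<Rightarrow> 'p set \<Rightarrow> 'p set \<Rightarrow> complex \<Rightarrow> complex)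
     \<Rightarrow> 'p group_vars \<Rightarrow> ('p set \<Rightarrow> 'p set \<Rightarrow> complex^2) \<Rightarrow> complex" where
  "action_S0 D l g \<xi> =
     (\<Sum>s\<in>{Plus, Minus}. \<Sum>v\<in>simplices4 D. \<Sum>\<Delta>\<in>tris_in D v.
        2 * of_real (J_tri_pm D s \<Delta>) * l s v \<Delta> (amp_tri D g \<xi> s v \<Delta>))"

definition branches_S ::
  "('p::euclidean_space, 'f) spinfoam_data \<Rightarrow> 'p group_vars \<Rightarrow> ('p set \<Rightarrow> 'f \<Rightarrow> complex^2)
     \<Rightarrow> (sign \<Rightarrow> 'p set \<Rightarrow> 'f \<Rightarrow> complex \<Rightarrow> complex) \<Rightarrow> bool" where
  "branches_S D g \<xi> l \<longleftrightarrow>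
     (\<forall>s. \<forall>v\<in>simplices4 D. \<forall>\<Delta>\<in>tris_in D v. \<forall>f\<in>facets D \<Delta>.
        log_branch_at (l s v f) (amp_facet D g \<xi> s v \<Delta> f))"

definition branches_S0 ::
  "('p::euclidean_space, 'f) spinfoam_data \<Rightarrow> 'p group_vars \<Rightarrow> ('p set \<Rightarrow> 'p set \<Rightarrow> complex^2)
     \<Rightarrow> (sign \<Rightarrow> 'p set \<Rightarrow> 'p set \<Rightarrow> complex \<Rightarrow> complex) \<Rightarrow> bool" where
  "branches_S0 D g \<xi> l \<longleftrightarrow>
     (\<forall>s. \<forall>v\<in>simplices4 D. \<forall>\<Delta>\<in>tris_in D v.
        log_branch_at (l s v \<Delta>) (amp_tri D g \<xi> s v \<Delta>))"

section \<open>Critical points\<close>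

definition upd_group ::
  "'p group_vars \<Rightarrow> sign \<Rightarrow> 'p set \<Rightarrow> 'p set \<Rightarrow> complex^2^2 \<Rightarrow> 'p group_vars" where
  "upd_group g s v \<alpha> h = g(s := (g s)(v := (g s v)(\<alpha> := h)))"

text \<open>The amplitudes are required to be nonzero, because otherwise the action is undefined at the
  configuration. Under this condition branches exist, and the remaining requirements do not depend
  on their choice.\<close>

definition critical_S ::
  "('p::euclidean_space, 'f) spinfoam_data \<Rightarrow> 'p group_vars
     \<Rightarrow> ('p set \<Rightarrow> 'f \<Rightarrow> complex^2) \<Rightarrow> bool" where
  "critical_S D g \<xi> \<longleftrightarrow>
     valid_group_vars D g \<and> valid_facet_vecs D \<xi> \<and>
     (\<forall>s. \<forall>v\<in>simplices4 D. \<forall>\<Delta>\<in>tris_in D v. \<forall>f\<in>facets D \<Delta>. amp_facet D g \<xi> s v \<Delta> f \<noteq> 0) \<and>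
     (\<forall>l. branches_S D g \<xi> l \<longrightarrow>
        Re (action_S D l g \<xi>) = 0 \<and>
        (\<forall>s. \<forall>v\<in>simplices4 D. \<forall>\<alpha>\<in>tets D. \<alpha> \<subseteq> v \<longrightarrow>
           stationary_on SU2 (\<lambda>h. action_S D l (upd_group g s v \<alpha> h) \<xi>) (g s v \<alpha>)) \<and>
        (\<forall>\<alpha>. internal_tet D \<alpha> \<longrightarrow> (\<forall>\<Delta>\<in>tris_in D \<alpha>. \<forall>f\<in>facets D \<Delta>.
           stationary_on (sphere 0 1)
             (\<lambda>x. action_S D l g (\<xi>(\<alpha> := (\<xi> \<alpha>)(f := x)))) (\<xi> \<alpha> f))))"

definition critical_S0 ::
  "('p::euclidean_space, 'f) spinfoam_data \<Rightarrow> 'p group_vars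
     \<Rightarrow> ('p set \<Rightarrow> 'p set \<Rightarrow> complex^2) \<Rightarrow> bool" where
  "critical_S0 D g \<xi> \<longleftrightarrow>
     valid_group_vars D g \<and> valid_tri_vecs D \<xi> \<and>
     (\<forall>s. \<forall>v\<in>simplices4 D. \<forall>\<Delta>\<in>tris_in D v. amp_tri D g \<xi> s v \<Delta> \<noteq> 0) \<and>
     (\<forall>l. branches_S0 D g \<xi> l \<longrightarrow>
        Re (action_S0 D l g \<xi>) = 0 \<and>
        (\<forall>s. \<forall>v\<in>simplices4 D. \<forall>\<alpha>\<in>tets D. \<alpha> \<subseteq> v \<longrightarrow>
           stationary_on SU2 (\<lambda>h. action_S0 D l (upd_group g s v \<alpha> h) \<xi>) (g s v \<alpha>)) \<and>
        (\<forall>\<alpha>. internal_tet D \<alpha> \<longrightarrow> (\<forall>\<Delta>\<in>tris_in D \<alpha>.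
           stationary_on (sphere 0 1)
             (\<lambda>x. action_S0 D l g (\<xi>(\<alpha> := (\<xi> \<alpha>)(\<Delta> := x)))) (\<xi> \<alpha> \<Delta>))))"

end

theory Submission
  imports Defs
begin

text \<open>
  With \<open>\<xi>\<close> parallel to \<open>\<xi>0\<close>, every facet amplitude is a unit constant times the amplitude of the
  triangle containing the facet, so branches of their logarithms differ by an imaginary constant
  near the configuration. Since \<open>J\<^sub>\<Delta>\<close> is the sum of the spins \<open>j\<^sub>f\<close>, the action \<open>S\<close>, as a function of
  the group variables, is \<open>S\<^sub>0\<close> plus an imaginary constant. As a function of a single vector at
  \<open>(\<alpha>, f)\<close>, it is an affine image of \<open>S\<^sub>0\<close> at the rotated vector, with slope \<open>j\<^sub>f / J\<^sub>\<Delta>\<close>.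
\<close>

section \<open>Vectors and matrices\<close>

lemma norm_vector_scalar_mult:
  fixes x :: "complex^'n"
  shows "norm (c *s x) = norm c * norm x"
proof -
  have "norm (c *s x) = L2_set (\<lambda>i. norm c * norm (x $ i)) UNIV"
    by (simp add: norm_vec_def norm_mult)
  then show ?thesis
    by (simp add: norm_vec_def L2_set_right_distrib)
qed

lemma bounded_linear_vector_scalar_mult:
  "bounded_linear (\<lambda>x::complex^'n. c *s x)"
  unfolding linear_conv_bounded_linear[symmetric]
  by (rule linearI) (auto simp: vec_eq_iff algebra_simps)

text \<open>The phase of the first vector enters conjugated. This is how a phase on each side of a
  group element turns into one scalar factor of the amplitude.\<close>

lemma braket_scale:
  "braket (a *s x) (A *v (b *s y)) = cnj a * b * braket x (A *v y)"
  by (simp add: braket_def vector_scalar_commute sum_distrib_left mult_ac)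

text \<open>\<open>matrix_inv\<close> is a choice among two-sided inverses. The adjoint is one, and
  two-sided inverses are unique. The explicit formula gives continuity of the inverse.\<close>

lemma matrix_inv_SU2:
  assumes "A \<in> SU2"
  shows "matrix_inv A = adjoint_mat A"
proof -
  have A: "A ** adjoint_mat A = mat 1" "adjoint_mat A ** A = mat 1"
    using assms by (auto simp: SU2_def)
  have "A ** matrix_inv A = mat 1 \<and> matrix_inv A ** A = mat 1"
    unfolding matrix_inv_def by (rule someI[of _ "adjoint_mat A"]) (use A in simp)
  then show ?thesis
    by (metis A(2) matrix_mul_assoc matrix_mul_lid matrix_mul_rid)
qed

lemma tendsto_braket:
  assumes "(X \<longlongrightarrow> x) F" "(Y \<longlongrightarrow> y) F"
  shows "((\<lambda>t. braket (X t) (Y t)) \<longlongrightarrow> braket x y) F"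
  unfolding braket_def by (intro tendsto_intros assms)

lemma tendsto_matrix_vector_mult:
  fixes A :: "complex^'n^'m"
  assumes "(M \<longlongrightarrow> A) F" "(Y \<longlongrightarrow> y) F"
  shows "((\<lambda>t. M t *v Y t) \<longlongrightarrow> A *v y) F"
  unfolding matrix_vector_mult_def by (intro tendsto_intros assms)

lemma tendsto_matrix_matrix_mult:
  fixes A :: "complex^'n^'m" and B :: "complex^'k^'n"
  assumes "(M \<longlongrightarrow> A) F" "(N \<longlongrightarrow> B) F"
  shows "((\<lambda>t. M t ** N t) \<longlongrightarrow> A ** B) F"
  unfolding matrix_matrix_mult_def by (intro tendsto_intros assms)

text \<open>The adjoint is continuous in the entries, and it agrees with the inverse on
  \<open>SU2\<close>; hence the limit is taken within \<open>SU2\<close>.\<close>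

lemma tendsto_matrix_inv_SU2:
  assumes "A \<in> SU2"
  shows "(matrix_inv \<longlongrightarrow> matrix_inv A) (at A within SU2)"
proof -
  have "((\<lambda>h. adjoint_mat h) \<longlongrightarrow> adjoint_mat A) (at A within SU2)"
    unfolding adjoint_mat_def by (intro tendsto_intros)
  moreover have "\<forall>\<^sub>F h in at A within SU2. adjoint_mat h = matrix_inv h"
    by (simp add: eventually_at_filter matrix_inv_SU2)
  ultimately show ?thesis
    using assms by (simp add: matrix_inv_SU2 tendsto_cong)
qed

section \<open>Branches of the logarithm\<close>

lemma log_branch_exists:
  assumes "w \<noteq> 0"
  shows "\<exists>l. log_branch_at l w"
proof
  \<comment> \<open>Division by w moves w to 1, away from the cut of \<open>Ln\<close>, so the same
    formula works when w lies on the negative real axis.\<close>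
  let ?l = "\<lambda>z. Ln (z / w) + Ln w"
  let ?U = "{z. z / w \<in> - \<real>\<^sub>\<le>\<^sub>0}"
  have "open ?U"
    using open_vimage[of "- \<real>\<^sub>\<le>\<^sub>0" "\<lambda>z. z / w"] assms
    by (auto simp: vimage_def continuous_intros)
  moreover have "?l holomorphic_on ?U"
    by (intro holomorphic_intros) (use assms in auto)
  moreover have "exp (?l z) = z" if "z \<in> ?U" for z
    using that assms by (cases "z = 0") (auto simp: exp_add)
  ultimately show "log_branch_at ?l w"
    unfolding log_branch_at_def using assms by (intro exI[of _ ?U]) auto
qed

lemma log_branch_isCont:
  assumes "log_branch_at l w"
  shows "isCont l w"
  using assms unfolding log_branch_at_def
  by (metis continuous_on_eq_continuous_at holomorphic_on_imp_continuous_on)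

lemma log_branch_eventually:
  assumes "log_branch_at l w"
  shows "\<forall>\<^sub>F z in nhds w. exp (l z) = z"
  using assms unfolding log_branch_at_def eventually_nhds by blast

lemma log_branch_exp: "log_branch_at l w \<Longrightarrow> exp (l w) = w"
  by (auto simp: log_branch_at_def)

lemma log_branch_Re: "log_branch_at l w \<Longrightarrow> Re (l w) = ln (norm w)"
  by (metis log_branch_exp norm_exp_eq_Re ln_exp)

text \<open>Both sides are logarithms of the same number c * z, so they differ by a multiple of 2 pi
  i. Their difference is continuous at w and zero there, hence smaller than 2 pi near w, and so it
  vanishes.\<close>

lemma log_branch_shift:
  assumes l: "log_branch_at l w" and l': "log_branch_at l' (c * w)"
  shows "\<forall>\<^sub>F z in nhds w. l' (c * z) = l z + (l' (c * w) - l w)"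
proof -
  have nz: "w \<noteq> 0"
    using log_branch_exp[OF l] exp_not_eq_zero[of "l w"] by simp
  have lim: "((\<lambda>z. c * z) \<longlongrightarrow> c * w) (nhds w)"
    by (rule tendsto_mult[OF tendsto_const filterlim_ident])
  have lim_l: "(l \<longlongrightarrow> l w) (nhds w)"
    using log_branch_isCont[OF l] by (simp add: isCont_def tendsto_at_iff_tendsto_nhds)
  have "(l' \<longlongrightarrow> l' (c * w)) (nhds (c * w))"
    using log_branch_isCont[OF l'] by (simp add: isCont_def tendsto_at_iff_tendsto_nhds)
  then have lim_l': "((\<lambda>z. l' (c * z)) \<longlongrightarrow> l' (c * w)) (nhds w)"
    using lim by (rule filterlim_compose)
  let ?d = "\<lambda>z. l' (c * z) - (l z + (l' (c * w) - l w))"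
  have "(?d \<longlongrightarrow> l' (c * w) - (l w + (l' (c * w) - l w))) (nhds w)"
    by (rule tendsto_diff[OF lim_l' tendsto_add[OF lim_l tendsto_const]])
  from tendstoD[OF this, of "2 * pi"]
  have "\<forall>\<^sub>F z in nhds w. norm (?d z) < 2 * pi"
    by (simp add: dist_norm)
  moreover have "\<forall>\<^sub>F z in nhds w. exp (l z) = z"
    by (rule log_branch_eventually[OF l])
  moreover have "\<forall>\<^sub>F z in nhds w. exp (l' (c * z)) = c * z"
    by (rule eventually_compose_filterlim[OF log_branch_eventually[OF l'] lim])
  ultimately show ?thesis
  proof eventually_elim
    case (elim z)
    have "exp (l z + (l' (c * w) - l w)) = z * (c * w / w)"
      by (simp only: exp_add exp_diff elim(2) log_branch_exp[OF l] log_branch_exp[OF l'])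
    then have "exp (l' (c * z)) = exp (l z + (l' (c * w) - l w))"
      unfolding elim(3) using nz by simp
    moreover have "\<bar>Im (l' (c * z)) - Im (l z + (l' (c * w) - l w))\<bar> < 2 * pi"
      using elim(1) abs_Im_le_cmod[of "?d z"] by (simp only: minus_complex.sel)
    ultimately show ?case
      by (rule exp_complex_eqI[rotated])
  qed
qed

section \<open>Vanishing differentials on a subset\<close>

text \<open>The filter \<open>at x within M\<close> leaves out x itself, so the relation between F
  and G is asked for separately at x.\<close>

lemma stationary_on_affine_transfer:
  assumes stat: "stationary_on M F x"
    and eq: "\<forall>\<^sub>F y in at x within M. G y = r * F y + c"
    and "G x = r * F x + c" "x \<in> M"
  shows "stationary_on M G x"
proof -
  have "((\<lambda>y. r * F y + c) has_derivative (\<lambda>h. r * 0 + 0)) (at x within M)"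
    using stat unfolding stationary_on_def by (intro derivative_intros)
  moreover have "\<forall>\<^sub>F y in at x within M. r * F y + c = G y"
    using eq by eventually_elim simp
  ultimately show ?thesis
    unfolding stationary_on_def
    using has_derivative_transform_eventually[of "\<lambda>y. r * F y + c" "\<lambda>_. 0" x M G] assms(3,4)
    by simp
qed

text \<open>The chain rule for a linear map that carries one constraint set into the other. It will
  be applied to multiplication by a phase, which preserves the unit sphere.\<close>

lemma stationary_on_compose_linear:
  assumes "stationary_on N F (L x)" "bounded_linear L" "L ` M \<subseteq> N"
  shows "stationary_on M (\<lambda>y. F (L y)) x"
  using has_derivative_in_compose[of L L x M F "\<lambda>_. 0"] assms
  by (auto simp: stationary_on_def bounded_linear_imp_has_derivative
      intro: has_derivative_subset)

section \<open>The two actions at parallel configurations\<close>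

lemma finite_simplices4: "spinfoam D \<Longrightarrow> finite (simplices4 D)"
  by (auto simp: spinfoam_def four_dim_complex_def simplicial_complex_def simplices4_def)

lemma finite_tris_in: "spinfoam D \<Longrightarrow> finite (tris_in D s)"
  by (auto simp: spinfoam_def four_dim_complex_def simplicial_complex_def tris_in_def tris_def)

lemma finite_facets: "spinfoam D \<Longrightarrow> \<Delta> \<in> tris_in D s \<Longrightarrow> finite (facets D \<Delta>)"
  by (auto simp: spinfoam_def valid_facets_def tris_in_def)

lemma tris_in_tet_of:
  assumes "spinfoam D" "v \<in> simplices4 D" "\<Delta> \<in> tris_in D v"
    "\<alpha> = first_tet D v \<Delta> \<or> \<alpha> = second_tet D v \<Delta>"
  shows "\<alpha> \<in> tets D" "\<alpha> \<subseteq> v" "\<Delta> \<in> tris_in D \<alpha>"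
proof -
  have "{first_tet D v \<Delta>, second_tet D v \<Delta>} = {\<alpha> \<in> tets D. \<Delta> \<subseteq> \<alpha> \<and> \<alpha> \<subseteq> v}"
    using assms by (auto simp: spinfoam_def consistent_orientation_def)
  then have "\<alpha> \<in> {\<alpha> \<in> tets D. \<Delta> \<subseteq> \<alpha> \<and> \<alpha> \<subseteq> v}"
    using assms(4) by blast
  then show "\<alpha> \<in> tets D" "\<alpha> \<subseteq> v" "\<Delta> \<in> tris_in D \<alpha>"
    using assms(3) by (auto simp: tris_in_def)
qed

lemma not_internal_imp_boundary:
  assumes "spinfoam D" "v \<in> simplices4 D" "\<alpha> \<in> tets D" "\<alpha> \<subseteq> v" "\<not> internal_tet D \<alpha>"
  shows "boundary_tet D \<alpha>"
proof -
  have "card {v \<in> simplices4 D. \<alpha> \<subseteq> v} \<le> 2"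
    using assms by (auto simp: spinfoam_def four_dim_complex_def)
  \<comment> \<open>The set contains the given 4-simplex v, and it is finite, so its cardinality is
    not the default value 0.\<close>
  moreover have "card {v \<in> simplices4 D. \<alpha> \<subseteq> v} \<noteq> 0"
    using assms finite_simplices4[OF assms(1)] by auto
  ultimately show ?thesis
    using assms by (auto simp: boundary_tet_def internal_tet_def)
qed

lemma spin_pos:
  assumes "spinfoam D" "\<Delta> \<in> tris_in D s" "f \<in> facets D \<Delta>"
  shows "spin D f > 0"
proof -
  have all: "\<forall>\<Delta>\<in>tris D. \<forall>f\<in>facets D \<Delta>. \<exists>n::nat. n > 0 \<and> spin D f = real n / 2"
    using assms(1) unfolding spinfoam_def valid_facets_def by (elim conjE)
  have "\<Delta> \<in> tris D"
    using assms(2) by (simp add: tris_in_def)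
  then obtain n :: nat where "n > 0" "spin D f = real n / 2"
    using bspec[OF bspec[OF all] assms(3)] by blast
  then show ?thesis
    by simp
qed

lemma J_tri_pos:
  assumes "spinfoam D" "\<Delta> \<in> tris_in D s"
  shows "J_tri D \<Delta> > 0"
  unfolding J_tri_def
proof (rule sum_pos)
  show "finite (facets D \<Delta>)"
    by (rule finite_facets[OF assms])
  show "facets D \<Delta> \<noteq> {}"
    using assms by (auto simp: spinfoam_def valid_facets_def tris_in_def)
qed (rule spin_pos[OF assms])

text \<open>A facet determines its triangle. Vectors and phases are indexed by a tetrahedron and a
  facet only, and this makes the triangle recoverable from that index.\<close>

lemma facets_unique:
  assumes "spinfoam D" "\<Delta> \<in> tris_in D s" "\<Delta>' \<in> tris_in D s'" "f \<in> facets D \<Delta>" "f \<in> facets D \<Delta>'"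
  shows "\<Delta> = \<Delta>'"
proof (rule ccontr)
  assume "\<Delta> \<noteq> \<Delta>'"
  then have "facets D \<Delta> \<inter> facets D \<Delta>' = {}"
    using assms(1-3) by (simp add: spinfoam_def valid_facets_def tris_in_def)
  then show False
    using assms(4,5) by blast
qed

section \<open>Comparison of amplitudes and actions at parallel configurations\<close>

lemma amp_parallel:
  assumes "facet_vec D \<xi> (first_tet D v \<Delta>) f = a *s tri_vec D \<xi>0 (first_tet D v \<Delta>) \<Delta>"
    and "facet_vec D \<xi> (second_tet D v \<Delta>) f = b *s tri_vec D \<xi>0 (second_tet D v \<Delta>) \<Delta>"
  shows "amp_facet D g \<xi> s v \<Delta> f = cnj a * b * amp_tri D g \<xi>0 s v \<Delta>"
  using assms by (simp add: amp_facet_def amp_tri_def Let_def braket_scale)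

text \<open>Merges two sources of phases into one function u: the given \<phi> at internal
  tetrahedra and the parallel restriction at boundary tetrahedra.\<close>

lemma parallel_phases_exist:
  assumes sf: "spinfoam D"
    and par: "\<And>\<alpha> \<Delta> f. internal_tet D \<alpha> \<Longrightarrow> \<Delta> \<in> tris_in D \<alpha> \<Longrightarrow> f \<in> facets D \<Delta> \<Longrightarrow>
           \<xi> \<alpha> f = cis (\<phi> \<alpha> f) *s \<xi>0 \<alpha> \<Delta>"
  shows "\<exists>u. (\<forall>\<alpha> f. internal_tet D \<alpha> \<longrightarrow> u \<alpha> f = cis (\<phi> \<alpha> f)) \<and> (\<forall>\<alpha> f. norm (u \<alpha> f) = 1) \<and>
    (\<forall>v \<Delta> \<alpha> f. v \<in> simplices4 D \<longrightarrow> \<Delta> \<in> tris_in D v \<longrightarrow> f \<in> facets D \<Delta> \<longrightarrow>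
       \<alpha> = first_tet D v \<Delta> \<or> \<alpha> = second_tet D v \<Delta> \<longrightarrow>
       facet_vec D \<xi> \<alpha> f = u \<alpha> f *s tri_vec D \<xi>0 \<alpha> \<Delta>)"
proof -
  \<comment> \<open>The quantifier over \<Delta> lets the phase be chosen from \<alpha> and f alone.
    Since only one triangle contains f, a phase valid for that triangle satisfies the whole
    condition.\<close>
  let ?P = "\<lambda>\<alpha> f \<theta>. \<forall>\<Delta>\<in>tris_in D \<alpha>. f \<in> facets D \<Delta> \<longrightarrow>
      bdry_facet D \<alpha> f = cis \<theta> *s bdry_tri D \<alpha> \<Delta>"
  define u where "u = (\<lambda>\<alpha> f. if internal_tet D \<alpha> then cis (\<phi> \<alpha> f) else cis (SOME \<theta>. ?P \<alpha> f \<theta>))"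
  show ?thesis
  proof (intro exI[of _ u] conjI allI impI)
    show "facet_vec D \<xi> \<alpha> f = u \<alpha> f *s tri_vec D \<xi>0 \<alpha> \<Delta>"
      if v: "v \<in> simplices4 D" and \<Delta>: "\<Delta> \<in> tris_in D v" and f: "f \<in> facets D \<Delta>"
        and \<alpha>: "\<alpha> = first_tet D v \<Delta> \<or> \<alpha> = second_tet D v \<Delta>" for v \<Delta> \<alpha> f
    proof (cases "internal_tet D \<alpha>")
      case True
      then show ?thesis
        using par[OF True tris_in_tet_of(3)[OF sf v \<Delta> \<alpha>] f]
        by (simp add: facet_vec_def tri_vec_def u_def)
    next
      case False
      have \<Delta>\<alpha>: "\<Delta> \<in> tris_in D \<alpha>"
        by (rule tris_in_tet_of(3)[OF sf v \<Delta> \<alpha>])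
      have "boundary_tet D \<alpha>"
        using not_internal_imp_boundary[OF sf v tris_in_tet_of(1,2)[OF sf v \<Delta> \<alpha>] False] .
      then obtain \<theta> where \<theta>: "bdry_facet D \<alpha> f = cis \<theta> *s bdry_tri D \<alpha> \<Delta>"
        using sf \<Delta>\<alpha> f unfolding spinfoam_def valid_boundary_def by blast
      have "?P \<alpha> f \<theta>"
        using \<theta> facets_unique[OF sf \<Delta>\<alpha> _ f] by blast
      then have "?P \<alpha> f (SOME \<theta>. ?P \<alpha> f \<theta>)"
        by (rule someI)
      then show ?thesis
        using False \<Delta>\<alpha> f by (simp add: facet_vec_def tri_vec_def u_def)
    qed
  qed (auto simp: u_def)
qed

text \<open>Apart from \<open>k\<close>, the logarithm is the same for all facets of a triangle, so
  their spins add up to \<open>J_tri\<close>. The remainder stays as an explicit sum, which is a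
  constant as long as \<open>k\<close> is fixed.\<close>

lemma action_S_eq_action_S0:
  assumes "\<And>s v \<Delta> f. v \<in> simplices4 D \<Longrightarrow> \<Delta> \<in> tris_in D v \<Longrightarrow> f \<in> facets D \<Delta> \<Longrightarrow>
    l s v f (amp_facet D g \<xi> s v \<Delta> f) = l0 s v \<Delta> (amp_tri D g \<xi>0 s v \<Delta>) + k s v \<Delta> f"
  shows "action_S D l g \<xi> = action_S0 D l0 g \<xi>0 +
    (\<Sum>s\<in>{Plus, Minus}. \<Sum>v\<in>simplices4 D. \<Sum>\<Delta>\<in>tris_in D v. \<Sum>f\<in>facets D \<Delta>.
        2 * of_real (spin_pm D s f) * k s v \<Delta> f)"
proof -
  have "(\<Sum>f\<in>facets D \<Delta>. 2 * of_real (spin_pm D s f) * l s v f (amp_facet D g \<xi> s v \<Delta> f)) =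
      2 * of_real (J_tri_pm D s \<Delta>) * l0 s v \<Delta> (amp_tri D g \<xi>0 s v \<Delta>) +
      (\<Sum>f\<in>facets D \<Delta>. 2 * of_real (spin_pm D s f) * k s v \<Delta> f)"
    if "v \<in> simplices4 D" "\<Delta> \<in> tris_in D v" for s v \<Delta>
    using that assms
    by (simp add: distrib_left sum.distrib J_tri_pm_def J_tri_def spin_pm_def
        sum_distrib_left sum_distrib_right)
  then show ?thesis
    unfolding action_S_def action_S0_def by (simp add: sum.distrib)
qed

section \<open>Continuity of the amplitudes in one variable\<close>

lemma tendsto_amp_tri_group:
  assumes A: "g s v \<alpha> \<in> SU2"
  shows "((\<lambda>h. amp_tri D (upd_group g s v \<alpha> h) \<xi> s' v' \<Delta>) \<longlongrightarrow> amp_tri D g \<xi> s' v' \<Delta>)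
    (at (g s v \<alpha>) within SU2)"
proof -
  let ?F = "at (g s v \<alpha>) within SU2"
  \<comment> \<open>Each entry is either the varied one, where the map is the identity, or constant
    in h.\<close>
  have upd: "((\<lambda>h. upd_group g s v \<alpha> h s' v' \<beta>) \<longlongrightarrow> g s' v' \<beta>) ?F" for \<beta>
    by (cases "s' = s"; cases "v' = v"; cases "\<beta> = \<alpha>") (simp_all add: upd_group_def)
  have inv: "((\<lambda>h. matrix_inv (upd_group g s v \<alpha> h s' v' \<beta>)) \<longlongrightarrow> matrix_inv (g s' v' \<beta>)) ?F" for \<beta>
    using tendsto_matrix_inv_SU2[OF A]
    by (cases "s' = s"; cases "v' = v"; cases "\<beta> = \<alpha>") (simp_all add: upd_group_def)
  show ?thesis
    unfolding amp_tri_def Let_def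
    by (intro tendsto_braket tendsto_matrix_vector_mult tendsto_matrix_matrix_mult upd inv
        tendsto_const)
qed

lemma tendsto_amp_tri_vec:
  assumes "(X \<longlongrightarrow> \<xi> \<alpha> \<Delta>) F"
  shows "((\<lambda>x. amp_tri D g (\<xi>(\<alpha> := (\<xi> \<alpha>)(\<Delta> := X x))) s v \<Delta>') \<longlongrightarrow> amp_tri D g \<xi> s v \<Delta>') F"
proof -
  have "((\<lambda>x. tri_vec D (\<xi>(\<alpha> := (\<xi> \<alpha>)(\<Delta> := X x))) \<beta> \<Delta>') \<longlongrightarrow> tri_vec D \<xi> \<beta> \<Delta>') F" for \<beta>
    using assms by (cases "\<beta> = \<alpha>"; cases "\<Delta>' = \<Delta>") (simp_all add: tri_vec_def)
  then show ?thesis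
    unfolding amp_tri_def Let_def
    by (intro tendsto_braket tendsto_matrix_vector_mult tendsto_const)
qed

text \<open>The actions have finitely many terms, so a common neighbourhood exists on which the
  relation between the logarithms holds for all of them at once.\<close>

lemma eventually_terms:
  assumes sf: "spinfoam D"
    and "\<And>s v \<Delta> f. v \<in> simplices4 D \<Longrightarrow> \<Delta> \<in> tris_in D v \<Longrightarrow> f \<in> facets D \<Delta> \<Longrightarrow>
      \<forall>\<^sub>F x in F. P x s v \<Delta> f"
  shows "\<forall>\<^sub>F x in F. \<forall>s::sign. \<forall>v\<in>simplices4 D. \<forall>\<Delta>\<in>tris_in D v. \<forall>f\<in>facets D \<Delta>. P x s v \<Delta> f"
proof -
  have "\<forall>\<^sub>F x in F. \<forall>v\<in>simplices4 D. \<forall>\<Delta>\<in>tris_in D v. \<forall>f\<in>facets D \<Delta>. P x s v \<Delta> f" for s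
    using assms(2) finite_simplices4[OF sf] finite_tris_in[OF sf] finite_facets[OF sf]
    by (intro eventually_ball_finite ballI) auto
  moreover have "(\<forall>s. Q s) \<longleftrightarrow> Q Plus \<and> Q Minus" for Q
    by (auto intro: sign.induct)
  ultimately show ?thesis
    by (simp only: eventually_conj)
qed

theorem theorem4p1:
  fixes D :: "('p::euclidean_space, 'f) spinfoam_data"
    and g :: "'p group_vars"
    and \<xi>0 :: "'p set \<Rightarrow> 'p set \<Rightarrow> complex^2"
    and \<xi> :: "'p set \<Rightarrow> 'f \<Rightarrow> complex^2"
    and \<phi> :: "'p set \<Rightarrow> 'f \<Rightarrow> real"
  assumes "spinfoam D"
    and "critical_S0 D g \<xi>0"
    and "\<And>\<alpha> \<Delta> f. internal_tet D \<alpha> \<Longrightarrow> \<Delta> \<in> tris_in D \<alpha> \<Longrightarrow> f \<in> facets D \<Delta> \<Longrightarrow>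
           \<xi> \<alpha> f = cis (\<phi> \<alpha> f) *s \<xi>0 \<alpha> \<Delta>"
  shows "critical_S D g \<xi>"
proof -
  note sf = assms(1) and crit = assms(2) and par = assms(3)
  obtain u where u_int: "\<And>\<alpha> f. internal_tet D \<alpha> \<Longrightarrow> u \<alpha> f = cis (\<phi> \<alpha> f)"
    and u_norm: "\<And>\<alpha> f. norm (u \<alpha> f) = 1"
    and u_vec: "\<And>v \<Delta> \<alpha> f. v \<in> simplices4 D \<Longrightarrow> \<Delta> \<in> tris_in D v \<Longrightarrow> f \<in> facets D \<Delta> \<Longrightarrow>
       \<alpha> = first_tet D v \<Delta> \<or> \<alpha> = second_tet D v \<Delta> \<Longrightarrow>
       facet_vec D \<xi> \<alpha> f = u \<alpha> f *s tri_vec D \<xi>0 \<alpha> \<Delta>"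
    using parallel_phases_exist[OF sf, of \<xi> \<phi> \<xi>0] par by metis
  \<comment> \<open>The phase between the facet amplitude and the triangle amplitude. It does not
    involve the group elements, so \<open>amp\<close> holds for every g' and can be used while g
    varies.\<close>
  define c where "c v \<Delta> f = cnj (u (first_tet D v \<Delta>) f) * u (second_tet D v \<Delta>) f" for v \<Delta> f
  have c_norm: "norm (c v \<Delta> f) = 1" for v \<Delta> f
    by (simp add: c_def norm_mult u_norm)
  have amp: "amp_facet D g' \<xi> s v \<Delta> f = c v \<Delta> f * amp_tri D g' \<xi>0 s v \<Delta>"
    if "v \<in> simplices4 D" "\<Delta> \<in> tris_in D v" "f \<in> facets D \<Delta>" for g' s v \<Delta> f
    unfolding c_def using u_vec[OF that] by (intro amp_parallel) auto
  have g_SU2: "g s v \<alpha> \<in> SU2" if "v \<in> simplices4 D" "\<alpha> \<in> tets D" "\<alpha> \<subseteq> v" for s v \<alpha>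
    using crit that by (auto simp: critical_S0_def valid_group_vars_def)
  have w_nz: "amp_tri D g \<xi>0 s v \<Delta> \<noteq> 0" if "v \<in> simplices4 D" "\<Delta> \<in> tris_in D v" for s v \<Delta>
    using crit that by (auto simp: critical_S0_def)
  \<comment> \<open>Criticality of S0 is assumed for all branches, so one fixed choice suffices
    here; the branches for S must remain arbitrary.\<close>
  define l0 where "l0 s v \<Delta> = (SOME l. log_branch_at l (amp_tri D g \<xi>0 s v \<Delta>))" for s v \<Delta>
  have l0: "log_branch_at (l0 s v \<Delta>) (amp_tri D g \<xi>0 s v \<Delta>)"
    if "v \<in> simplices4 D" "\<Delta> \<in> tris_in D v" for s v \<Delta>
    unfolding l0_def using log_branch_exists[OF w_nz[OF that]] by (rule someI_ex)
  then have br0: "branches_S0 D g \<xi>0 l0"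
    by (simp add: branches_S0_def)
  have unit: "valid_facet_vecs D \<xi>"
    using crit par
    by (auto simp: critical_S0_def valid_facet_vecs_def valid_tri_vecs_def norm_vector_scalar_mult)
  have "\<forall>l. branches_S D g \<xi> l \<longrightarrow> Re (action_S D l g \<xi>) = 0 \<and>
        (\<forall>s. \<forall>v\<in>simplices4 D. \<forall>\<alpha>\<in>tets D. \<alpha> \<subseteq> v \<longrightarrow>
           stationary_on SU2 (\<lambda>h. action_S D l (upd_group g s v \<alpha> h) \<xi>) (g s v \<alpha>)) \<and>
        (\<forall>\<alpha>. internal_tet D \<alpha> \<longrightarrow> (\<forall>\<Delta>\<in>tris_in D \<alpha>. \<forall>f\<in>facets D \<Delta>.
           stationary_on (sphere 0 1)
             (\<lambda>x. action_S D l g (\<xi>(\<alpha> := (\<xi> \<alpha>)(f := x)))) (\<xi> \<alpha> f)))"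
    (is "\<forall>l. _ \<longrightarrow> ?crit l")
  proof (intro allI impI)
    fix l
    assume br: "branches_S D g \<xi> l"
    have l: "log_branch_at (l s v f) (c v \<Delta> f * amp_tri D g \<xi>0 s v \<Delta>)"
      if "v \<in> simplices4 D" "\<Delta> \<in> tris_in D v" "f \<in> facets D \<Delta>" for s v \<Delta> f
      unfolding amp[OF that, symmetric] using br that by (simp add: branches_S_def)
    \<comment> \<open>The constant by which the given branch for S exceeds \<open>l0\<close>,
      evaluated at the configuration; by \<open>shift\<close> it is the same nearby.\<close>
    define k where "k s v \<Delta> f =
      l s v f (c v \<Delta> f * amp_tri D g \<xi>0 s v \<Delta>) - l0 s v \<Delta> (amp_tri D g \<xi>0 s v \<Delta>)" for s v \<Delta> f
    have shift: "\<forall>\<^sub>F z in nhds (amp_tri D g \<xi>0 s v \<Delta>).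
        l s v f (c v \<Delta> f * z) = l0 s v \<Delta> z + k s v \<Delta> f"
      if "v \<in> simplices4 D" "\<Delta> \<in> tris_in D v" "f \<in> facets D \<Delta>" for s v \<Delta> f
      unfolding k_def by (rule log_branch_shift[OF l0[OF that(1,2)] l[OF that]])
    define K where "K = (\<Sum>s\<in>{Plus, Minus}. \<Sum>v\<in>simplices4 D. \<Sum>\<Delta>\<in>tris_in D v. \<Sum>f\<in>facets D \<Delta>.
        2 * of_real (spin_pm D s f) * k s v \<Delta> f)"
    \<comment> \<open>The real part of any branch is the logarithm of the modulus, and c has modulus
      1.\<close>
    have "Re (k s v \<Delta> f) = 0"
      if "v \<in> simplices4 D" "\<Delta> \<in> tris_in D v" "f \<in> facets D \<Delta>" for s v \<Delta> f
      using log_branch_Re[OF l0[OF that(1,2)], of s] log_branch_Re[OF l[OF that], of s]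
      by (simp add: k_def norm_mult c_norm)
    then have "Re K = 0"
      by (simp add: K_def)
    have S_eq: "action_S D l g \<xi> = action_S0 D l0 g \<xi>0 + K"
      unfolding K_def using amp by (intro action_S_eq_action_S0) (simp add: k_def)
    have Re: "Re (action_S D l g \<xi>) = 0"
      using crit br0 S_eq \<open>Re K = 0\<close> by (simp add: critical_S0_def)
    have stat_group: "stationary_on SU2 (\<lambda>h. action_S D l (upd_group g s v \<alpha> h) \<xi>) (g s v \<alpha>)"
      if v: "v \<in> simplices4 D" "\<alpha> \<in> tets D" "\<alpha> \<subseteq> v" for s v \<alpha>
    proof -
      have stat0: "stationary_on SU2 (\<lambda>h. action_S0 D l0 (upd_group g s v \<alpha> h) \<xi>0) (g s v \<alpha>)"
        using crit br0 v by (simp add: critical_S0_def)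
      let ?F = "at (g s v \<alpha>) within SU2"
      let ?a = "\<lambda>h s' v' \<Delta>. amp_tri D (upd_group g s v \<alpha> h) \<xi>0 s' v' \<Delta>"
      have lim: "((\<lambda>h. ?a h s' v' \<Delta>) \<longlongrightarrow> amp_tri D g \<xi>0 s' v' \<Delta>) ?F" for s' v' \<Delta>
        by (rule tendsto_amp_tri_group) (rule g_SU2[OF v])
      have "\<forall>\<^sub>F h in ?F. \<forall>s'. \<forall>v'\<in>simplices4 D. \<forall>\<Delta>\<in>tris_in D v'. \<forall>f\<in>facets D \<Delta>.
          l s' v' f (c v' \<Delta> f * ?a h s' v' \<Delta>) = l0 s' v' \<Delta> (?a h s' v' \<Delta>) + k s' v' \<Delta> f"
        by (intro eventually_terms[OF sf] eventually_compose_filterlim[OF shift lim])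
      \<comment> \<open>The slope 1 is written out to match the affine form of
        \<open>stationary_on_affine_transfer\<close>.\<close>
      then have ev: "\<forall>\<^sub>F h in ?F. action_S D l (upd_group g s v \<alpha> h) \<xi> =
          1 * action_S0 D l0 (upd_group g s v \<alpha> h) \<xi>0 + K"
      proof eventually_elim
        case (elim h)
        then show ?case
          unfolding K_def mult_1 by (intro action_S_eq_action_S0) (simp add: amp)
      qed
      have base: "action_S D l (upd_group g s v \<alpha> (g s v \<alpha>)) \<xi> =
          1 * action_S0 D l0 (upd_group g s v \<alpha> (g s v \<alpha>)) \<xi>0 + K"
        using S_eq by (simp add: upd_group_def)
      show ?thesis
        by (rule stationary_on_affine_transfer[OF stat0 ev base g_SU2[OF v]])
    qed
    have stat_vec: "stationary_on (sphere 0 1)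
        (\<lambda>x. action_S D l g (\<xi>(\<alpha> := (\<xi> \<alpha>)(f := x)))) (\<xi> \<alpha> f)"
      if \<alpha>: "internal_tet D \<alpha>" and \<Delta>: "\<Delta> \<in> tris_in D \<alpha>" and f: "f \<in> facets D \<Delta>" for \<alpha> \<Delta> f
    proof -
      \<comment> \<open>\<open>L\<close> undoes the phase between \<xi> and \<xi>0 at \<alpha> and
        f, so the triangle vector of \<open>Y x\<close> at \<alpha> is parallel to the varied facet
        vector x, with the old phase.\<close>
      define L where "L x = cis (- \<phi> \<alpha> f) *s x" for x :: "complex^2"
      define X where "X x = \<xi>(\<alpha> := (\<xi> \<alpha>)(f := x))" for x
      define Y where "Y x = \<xi>0(\<alpha> := (\<xi>0 \<alpha>)(\<Delta> := L x))" for x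
      \<comment> \<open>The share of f in the spin of its triangle. The factor
        \<open>pm_factor\<close> cancels in this ratio, so one r serves both signs.\<close>
      define r where "r = spin D f / J_tri D \<Delta>"
      have L_base: "L (\<xi> \<alpha> f) = \<xi>0 \<alpha> \<Delta>"
        using par[OF \<alpha> \<Delta> f] by (simp add: L_def cis_mult)
      have L_lin: "bounded_linear L"
        unfolding L_def by (rule bounded_linear_vector_scalar_mult)
      have "stationary_on (sphere 0 1)
          (\<lambda>y. action_S0 D l0 g (\<xi>0(\<alpha> := (\<xi>0 \<alpha>)(\<Delta> := y)))) (L (\<xi> \<alpha> f))"
        using crit br0 \<alpha> \<Delta> by (simp add: critical_S0_def L_base)
      then have stat0: "stationary_on (sphere 0 1) (\<lambda>x. action_S0 D l0 g (Y x)) (\<xi> \<alpha> f)"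
        unfolding Y_def using L_lin
        by (rule stationary_on_compose_linear) (auto simp: L_def norm_vector_scalar_mult)
      have X_base: "X (\<xi> \<alpha> f) = \<xi>" and Y_base: "Y (\<xi> \<alpha> f) = \<xi>0"
        by (simp_all add: X_def Y_def L_base)
      have vec_X: "facet_vec D (X x) \<beta> f = u \<beta> f *s tri_vec D (Y x) \<beta> \<Delta>"
        if "v \<in> simplices4 D" "\<Delta> \<in> tris_in D v"
          "\<beta> = first_tet D v \<Delta> \<or> \<beta> = second_tet D v \<Delta>" for x \<beta> v
        using u_vec[OF that(1,2) f that(3)] \<alpha> u_int[OF \<alpha>, of f]
        by (auto simp: facet_vec_def tri_vec_def X_def Y_def L_def cis_mult)
      have amp_X: "amp_facet D g (X x) s v \<Delta> f = c v \<Delta> f * amp_tri D g (Y x) s v \<Delta>"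
        if "v \<in> simplices4 D" "\<Delta> \<in> tris_in D v" for x s v
        unfolding c_def using vec_X[OF that] by (intro amp_parallel) auto
      \<comment> \<open>The other facets of \<Delta> keep their vectors while the triangle vector
        moves in \<open>Y x\<close>. Hence S is compared with S0 through increments from the base
        point, where these facets contribute nothing.\<close>
      have amp_other: "amp_facet D g (X x) s v \<Delta>' f' = amp_facet D g \<xi> s v \<Delta>' f'"
        if "f' \<noteq> f" for x s v \<Delta>' f'
      proof -
        have "facet_vec D (X x) \<beta> f' = facet_vec D \<xi> \<beta> f'" for \<beta>
          using that by (simp add: facet_vec_def X_def fun_upd_def)
        then show ?thesis
          by (simp add: amp_facet_def)
      qed
      have tri_other: "amp_tri D g (Y x) s v \<Delta>' = amp_tri D g \<xi>0 s v \<Delta>'"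
        if "\<Delta>' \<noteq> \<Delta>" for x s v \<Delta>'
      proof -
        have "tri_vec D (Y x) \<beta> \<Delta>' = tri_vec D \<xi>0 \<beta> \<Delta>'" for \<beta>
          using that by (simp add: tri_vec_def Y_def fun_upd_def)
        then show ?thesis
          by (simp add: amp_tri_def)
      qed
      let ?T = "\<lambda>x s v \<Delta>' f'. 2 * of_real (spin_pm D s f') * l s v f' (amp_facet D g (X x) s v \<Delta>' f')"
      let ?R = "\<lambda>x s v \<Delta>'. 2 * of_real (J_tri_pm D s \<Delta>') * l0 s v \<Delta>' (amp_tri D g (Y x) s v \<Delta>')"
      let ?b = "\<xi> \<alpha> f"
      have affine: "action_S D l g (X x) = of_real r * action_S0 D l0 g (Y x) +
          (action_S D l g \<xi> - of_real r * action_S0 D l0 g \<xi>0)"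
        if near: "\<forall>s. \<forall>v\<in>simplices4 D. \<forall>\<Delta>'\<in>tris_in D v. \<forall>f'\<in>facets D \<Delta>'.
            l s v f' (c v \<Delta>' f' * amp_tri D g (Y x) s v \<Delta>') =
            l0 s v \<Delta>' (amp_tri D g (Y x) s v \<Delta>') + k s v \<Delta>' f'" for x
      proof -
        \<comment> \<open>Increments are compared triangle by triangle. Away from \<Delta> both
          vanish; at \<Delta> the left side reduces to the term of f, in which the constant
          \<open>k\<close> cancels.\<close>
        have "(\<Sum>f'\<in>facets D \<Delta>'. ?T x s v \<Delta>' f' - ?T ?b s v \<Delta>' f') =
            of_real r * (?R x s v \<Delta>' - ?R ?b s v \<Delta>')"
          if v: "v \<in> simplices4 D" and \<Delta>': "\<Delta>' \<in> tris_in D v" for s v \<Delta>'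
        proof (cases "\<Delta>' = \<Delta>")
          case False
          then have "f \<notin> facets D \<Delta>'"
            using facets_unique[OF sf \<Delta> \<Delta>' f] by blast
          then have "?T x s v \<Delta>' f' - ?T ?b s v \<Delta>' f' = 0" if "f' \<in> facets D \<Delta>'" for f'
            using that by (metis amp_other diff_self)
          then have "(\<Sum>f'\<in>facets D \<Delta>'. ?T x s v \<Delta>' f' - ?T ?b s v \<Delta>' f') = 0"
            by (rule sum.neutral[OF ballI])
          then show ?thesis
            using tri_other[OF False] by simp
        next
          case True
          have "(\<Sum>f'\<in>facets D \<Delta>'. ?T x s v \<Delta>' f' - ?T ?b s v \<Delta>' f') =
              (\<Sum>f'\<in>facets D \<Delta>'. if f' = f then ?T x s v \<Delta>' f - ?T ?b s v \<Delta>' f else 0)"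
            by (intro sum.cong) (auto simp: amp_other)
          also have "\<dots> = ?T x s v \<Delta> f - ?T ?b s v \<Delta> f"
            using True f finite_facets[OF sf \<Delta>] by simp
          also have "\<dots> = 2 * of_real (spin_pm D s f) *
              (l0 s v \<Delta> (amp_tri D g (Y x) s v \<Delta>) - l0 s v \<Delta> (amp_tri D g \<xi>0 s v \<Delta>))"
          proof -
            have "l s v f (amp_facet D g (X x) s v \<Delta> f) = l0 s v \<Delta> (amp_tri D g (Y x) s v \<Delta>) + k s v \<Delta> f"
              using near v \<Delta>' f True by (simp add: amp_X)
            moreover have "l s v f (amp_facet D g (X ?b) s v \<Delta> f) = l0 s v \<Delta> (amp_tri D g \<xi>0 s v \<Delta>) + k s v \<Delta> f"
              using v \<Delta>' True by (simp add: amp_X Y_base k_def)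
            ultimately show ?thesis
              by (simp only: algebra_simps)
          qed
          \<comment> \<open>Positivity of \<open>J_tri\<close> allows the denominator of r to be
            cancelled.\<close>
          also have "spin_pm D s f = r * J_tri_pm D s \<Delta>"
            using J_tri_pos[OF sf \<Delta>] by (simp add: spin_pm_def J_tri_pm_def r_def)
          finally show ?thesis
            by (simp add: True Y_base algebra_simps)
        qed
        then have "(\<Sum>s\<in>{Plus, Minus}. \<Sum>v\<in>simplices4 D. \<Sum>\<Delta>'\<in>tris_in D v. \<Sum>f'\<in>facets D \<Delta>'.
              ?T x s v \<Delta>' f' - ?T ?b s v \<Delta>' f') =
            (\<Sum>s\<in>{Plus, Minus}. \<Sum>v\<in>simplices4 D. \<Sum>\<Delta>'\<in>tris_in D v.
              of_real r * (?R x s v \<Delta>' - ?R ?b s v \<Delta>'))"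
          by (intro sum.cong refl)
        then have "action_S D l g (X x) - action_S D l g (X ?b) =
            of_real r * (action_S0 D l0 g (Y x) - action_S0 D l0 g (Y ?b))"
          by (simp only: action_S_def action_S0_def sum_subtractf sum_distrib_left[symmetric])
        then show ?thesis
          by (simp add: X_base Y_base algebra_simps)
      qed
      let ?F = "at ?b within sphere 0 1"
      \<comment> \<open>As x tends to the base vector, \<open>Y x\<close> tends to \<xi>0, so the
        amplitudes enter the neighbourhoods where \<open>shift\<close> applies.\<close>
      have "(L \<longlongrightarrow> \<xi>0 \<alpha> \<Delta>) ?F"
        using bounded_linear.tendsto[OF L_lin tendsto_ident_at, of ?b "sphere 0 1"]
        by (simp add: L_base)
      then have lim: "((\<lambda>x. amp_tri D g (Y x) s v \<Delta>') \<longlongrightarrow> amp_tri D g \<xi>0 s v \<Delta>') ?F" for s v \<Delta>'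
        unfolding Y_def by (rule tendsto_amp_tri_vec)
      have "\<forall>\<^sub>F x in ?F. \<forall>s. \<forall>v\<in>simplices4 D. \<forall>\<Delta>'\<in>tris_in D v. \<forall>f'\<in>facets D \<Delta>'.
          l s v f' (c v \<Delta>' f' * amp_tri D g (Y x) s v \<Delta>') =
          l0 s v \<Delta>' (amp_tri D g (Y x) s v \<Delta>') + k s v \<Delta>' f'"
        by (intro eventually_terms[OF sf] eventually_compose_filterlim[OF shift lim])
      then have ev: "\<forall>\<^sub>F x in ?F. action_S D l g (\<xi>(\<alpha> := (\<xi> \<alpha>)(f := x))) =
          of_real r * action_S0 D l0 g (Y x) +
          (action_S D l g \<xi> - of_real r * action_S0 D l0 g \<xi>0)"
        unfolding X_def[symmetric] by eventually_elim (rule affine)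
      have base: "action_S D l g (\<xi>(\<alpha> := (\<xi> \<alpha>)(f := \<xi> \<alpha> f))) =
          of_real r * action_S0 D l0 g (Y ?b) +
          (action_S D l g \<xi> - of_real r * action_S0 D l0 g \<xi>0)"
        by (simp add: Y_base)
      have "\<xi> \<alpha> f \<in> sphere 0 1"
        using unit \<alpha> \<Delta> f by (auto simp: valid_facet_vecs_def)
      with stat0 ev base show ?thesis
        by (rule stationary_on_affine_transfer)
    qed
    show "?crit l"
      using Re stat_group stat_vec by blast
  qed
  moreover have "\<forall>s. \<forall>v\<in>simplices4 D. \<forall>\<Delta>\<in>tris_in D v. \<forall>f\<in>facets D \<Delta>.
      amp_facet D g \<xi> s v \<Delta> f \<noteq> 0"
  proof (intro allI ballI)
    fix s v \<Delta> f
    assume *: "v \<in> simplices4 D" "\<Delta> \<in> tris_in D v" "f \<in> facets D \<Delta>"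
    show "amp_facet D g \<xi> s v \<Delta> f \<noteq> 0"
      using amp[OF *] w_nz[OF *(1,2)] c_norm[of v \<Delta> f] by auto
  qed
  moreover have "valid_group_vars D g"
    using crit by (simp add: critical_S0_def)
  ultimately show ?thesis
    unfolding critical_S_def using unit by (intro conjI)
qed

end
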